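(* Let $(\Omega,\mathcal{F},\tau)$ be a PM-space and let $\Sigma=P(\Omega)$ be the power set of $\Omega$. Then the class $$\mathbb{S}_\tau=\{E\in\Sigma:\ E\text{ is }\Lambda^{\mathcal{H}}\text{-measurable w.r.t. }\tau\}$$ is an algebra (of subsets of $\Omega$).
   Context: $\Delta^+$ is the set of distance distribution functions: all $F:[-\infty,+\infty]\to[0,1]$ that are non-decreasing, left-continuous on $\mathbb{R}$, with $F(-\infty)=0$, $F(0)=0$ and $F(+\infty)=1$ (so an element is determined by its values on $]0,+\infty[$). It is ordered pointwise. The element $\varepsilon_0\in\Delta^+$ is given by $\varepsilon_0(x)=1$ for $x>0$ and $\varepsilon_0(x)=0$ otherwise. A triangle function is a mapping $\tau:\Delta^+\times\Delta^+\to\Delta^+$ that is symmetric, associative, non-decreasing in each variable, and has $\varepsilon_0$ as identity. A probabilistic metric space (PM-space) $(\Omega,\mathcal{F},\tau)$ is a non-empty set $\Omega$ with a triangle function $\tau$ and a family $\mathcal{F}$ of functions $H_{p,q}\in\Delta^+$ ($p,q\in\Omega$) such that for all $p,q,r\in\Omega$: $H_{p,q}=\varepsilon_0$ iff $p=q$; $H_{p,q}=H_{q,p}$; $H_{p,r}\geq\tau(H_{p,q},H_{q,r})$. The probabilistic Hausdorff distance between $E,F\subseteq\Omega$ is $\mathcal{H}_{E,F}(0)=0$ and, for $t\in]0,+\infty[$, $$\mathcal{H}_{E,F}(t)=\sup_{s<t}\min\Bigl\{\inf_{p\in E}\sup_{q\in F}H_{p,q}(s),\ \inf_{q\in F}\sup_{p\in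 E}H_{p,q}(s)\Bigr\},$$ where, in $[0,1]$, a supremum over the empty set is $0$ and an infimum over the empty set is $1$; it is regarded as an element of $\Delta^+$ by setting it $0$ on negative arguments and $1$ at $+\infty$. Define $\Lambda^{\mathcal{H}}:\Sigma\to\Delta^+$ by $\Lambda^{\mathcal{H}}_E:=\mathcal{H}_{E^c,\Omega}$, where $E^c=\Omega\setminus E$. A set $E\in\Sigma$ is $\Lambda^{\mathcal{H}}$-measurable w.r.t. $\tau$ if $\Lambda^{\mathcal{H}}_G=\tau(\Lambda^{\mathcal{H}}_{G\cap E},\Lambda^{\mathcal{H}}_{G\cap E^c})$ for every $G\in\Sigma$. *)

theory Defs
  imports "HOL-Library.Extended_Real" "HOL-Analysis.Sigma_Algebra"
begin

definition Delta_plus :: "(ereal \<Rightarrow> real) set" where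
  "Delta_plus = {F. range F \<subseteq> {0..1} \<and> mono F
     \<and> (\<forall>x::real. continuous (at_left (ereal x)) F)
     \<and> F (-\<infinity>) = 0 \<and> F 0 = 0 \<and> F \<infinity> = 1}"

definition eps0 :: "ereal \<Rightarrow> real" where
  "eps0 x = (if x > 0 then 1 else 0)"

text \<open>A triangle function is a total function of which only the values on \<open>Delta_plus\<close> matter.\<close>

locale triangle_function =
  fixes \<tau> :: "(ereal \<Rightarrow> real) \<Rightarrow> (ereal \<Rightarrow> real) \<Rightarrow> (ereal \<Rightarrow> real)"
  assumes closed: "\<lbrakk>F \<in> Delta_plus; G \<in> Delta_plus\<rbrakk> \<Longrightarrow> \<tau> F G \<in> Delta_plus"
    and sym: "\<lbrakk>F \<in> Delta_plus; G \<in> Delta_plus\<rbrakk> \<Longrightarrow> \<tau> F G = \<tau> G F"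
    and assoc: "\<lbrakk>F \<in> Delta_plus; G \<in> Delta_plus; K \<in> Delta_plus\<rbrakk>
      \<Longrightarrow> \<tau> (\<tau> F G) K = \<tau> F (\<tau> G K)"
    and mono_left: "\<lbrakk>F \<in> Delta_plus; G \<in> Delta_plus; K \<in> Delta_plus; F \<le> G\<rbrakk>
      \<Longrightarrow> \<tau> F K \<le> \<tau> G K"
    and mono_right: "\<lbrakk>F \<in> Delta_plus; G \<in> Delta_plus; K \<in> Delta_plus; F \<le> G\<rbrakk>
      \<Longrightarrow> \<tau> K F \<le> \<tau> K G"
    and identity: "F \<in> Delta_plus \<Longrightarrow> \<tau> F eps0 = F" "F \<in> Delta_plus \<Longrightarrow> \<tau> eps0 F = F"

locale PM_space = triangle_function \<tau>
  for \<Omega> :: "'a set" and H :: "'a \<Rightarrow> 'a \<Rightarrow> ereal \<Rightarrow> real" and \<tau> +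
  assumes nonempty: "\<Omega> \<noteq> {}"
    and dist_in: "\<lbrakk>p \<in> \<Omega>; q \<in> \<Omega>\<rbrakk> \<Longrightarrow> H p q \<in> Delta_plus"
    and dist_eq_eps0_iff: "\<lbrakk>p \<in> \<Omega>; q \<in> \<Omega>\<rbrakk> \<Longrightarrow> H p q = eps0 \<longleftrightarrow> p = q"
    and dist_commute: "\<lbrakk>p \<in> \<Omega>; q \<in> \<Omega>\<rbrakk> \<Longrightarrow> H p q = H q p"
    and dist_triangle: "\<lbrakk>p \<in> \<Omega>; q \<in> \<Omega>; r \<in> \<Omega>\<rbrakk>
      \<Longrightarrow> H p r \<ge> \<tau> (H p q) (H q r)"

text \<open>Supremum and infimum of subsets of the unit interval, taken in the unit interval:
  the inserted bound changes nothing for a nonempty set and gives the supremum \<open>0\<close>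
  and the infimum \<open>1\<close> of the empty set, on which the real \<open>Sup\<close> and \<open>Inf\<close> are unspecified.\<close>

definition Sup01 :: "real set \<Rightarrow> real" where
  "Sup01 A = Sup (insert 0 A)"

definition Inf01 :: "real set \<Rightarrow> real" where
  "Inf01 A = Inf (insert 1 A)"

definition prob_Hausdorff ::
  "('a \<Rightarrow> 'a \<Rightarrow> ereal \<Rightarrow> real) \<Rightarrow> 'a set \<Rightarrow> 'a set \<Rightarrow> ereal \<Rightarrow> real" where
  "prob_Hausdorff H E F t =
    (if t \<le> 0 then 0
     else if t = \<infinity> then 1
     else Sup01 ((\<lambda>s. min (Inf01 ((\<lambda>p. Sup01 ((\<lambda>q. H p q s) ` F)) ` E))
                           (Inf01 ((\<lambda>q. Sup01 ((\<lambda>p. H p q s) ` E)) ` F))) ` {s. s < t}))"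

definition Lambda_H ::
  "'a set \<Rightarrow> ('a \<Rightarrow> 'a \<Rightarrow> ereal \<Rightarrow> real) \<Rightarrow> 'a set \<Rightarrow> ereal \<Rightarrow> real" where
  "Lambda_H \<Omega> H E = prob_Hausdorff H (\<Omega> - E) \<Omega>"

definition tau_measurable ::
  "'a set \<Rightarrow> 'a set set \<Rightarrow> ('a set \<Rightarrow> ereal \<Rightarrow> real)
    \<Rightarrow> ((ereal \<Rightarrow> real) \<Rightarrow> (ereal \<Rightarrow> real) \<Rightarrow> (ereal \<Rightarrow> real)) \<Rightarrow> 'a set \<Rightarrow> bool" where
  "tau_measurable \<Omega> \<Sigma> \<Lambda> \<tau> E \<longleftrightarrow>
    (\<forall>G\<in>\<Sigma>. \<Lambda> G = \<tau> (\<Lambda> (G \<inter> E)) (\<Lambda> (G \<inter> (\<Omega> - E))))"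

end

theory Submission
  imports Defs
begin

text \<open>Caratheodory's argument with \<open>\<tau>\<close> in place of addition: since
  \<open>\<Lambda>\<close> takes values in \<open>Delta_plus\<close> and sends the empty set to \<open>\<epsilon>\<^sub>0\<close>, the commutative
  monoid laws of \<open>\<tau>\<close> alone show that the measurable sets form an algebra.\<close>

lemma Sup01_in:
  assumes "A \<subseteq> {0..1}"
  shows "Sup01 A \<in> {0..1}"
proof -
  have "bdd_above (insert 0 A)"
    using assms by (auto intro!: bdd_aboveI[of _ 1])
  then have "0 \<le> Sup (insert 0 A)"
    by (intro cSup_upper) auto
  moreover have "Sup (insert 0 A) \<le> 1"
    using assms by (intro cSup_least) auto
  ultimately show ?thesis
    by (simp add: Sup01_def)
qed

lemma Sup01_upper:
  assumes "A \<subseteq> {0..1}" "x \<in> A"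
  shows "x \<le> Sup01 A"
  unfolding Sup01_def using assms
  by (intro cSup_upper bdd_aboveI[of _ 1]) auto

lemma Sup01_mono:
  assumes "A \<subseteq> B" "B \<subseteq> {0..1}"
  shows "Sup01 A \<le> Sup01 B"
  unfolding Sup01_def using assms
  by (intro cSup_subset_mono bdd_aboveI[of _ 1]) auto

lemma Sup01_eq_1:
  assumes "A \<subseteq> {0..1}" "1 \<in> A"
  shows "Sup01 A = 1"
  using Sup01_in[OF assms(1)] Sup01_upper[OF assms] by simp

lemma Inf01_in:
  assumes "A \<subseteq> {0..1}"
  shows "Inf01 A \<in> {0..1}"
proof -
  have "bdd_below (insert 1 A)"
    using assms by (auto intro!: bdd_belowI[of _ 0])
  then have "Inf (insert 1 A) \<le> 1"
    by (intro cInf_lower) auto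
  moreover have "0 \<le> Inf (insert 1 A)"
    using assms by (intro cInf_greatest) auto
  ultimately show ?thesis
    by (simp add: Inf01_def)
qed

text \<open>The supremum runs over strictly smaller arguments. Enlarging t enlarges the index set,
  which gives monotonicity; a value above a is witnessed by some s < x, and that same s serves every
  u between s and x, which gives left-continuity for arbitrary f.\<close>

lemma left_regularization_in_Delta_plus:
  fixes f :: "ereal \<Rightarrow> real"
  assumes f: "\<And>s. f s \<in> {0..1}"
  shows "(\<lambda>t. if t \<le> 0 then 0 else if t = \<infinity> then 1 else Sup01 (f ` {s. s < t})) \<in> Delta_plus"
    (is "?K \<in> _")
proof -
  have sub: "f ` S \<subseteq> {0..1}" for S
    using f by blast
  have range: "range ?K \<subseteq> {0..1}"
    using Sup01_in[OF sub] by auto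
  have mono: "mono ?K"
  proof (rule monoI)
    fix x y :: ereal
    assume "x \<le> y"
    then have "Sup01 (f ` {s. s < x}) \<le> Sup01 (f ` {s. s < y})"
      by (intro Sup01_mono image_mono sub) auto
    with \<open>x \<le> y\<close> show "?K x \<le> ?K y"
      using Sup01_in[OF sub, of "{s. s < x}"] Sup01_in[OF sub, of "{s. s < y}"]
      by auto
  qed
  have "(?K \<longlongrightarrow> ?K (ereal x)) (at_left (ereal x))" for x :: real
  proof (rule order_tendstoI)
    fix a
    assume a: "a < ?K (ereal x)"
    show "\<forall>\<^sub>F u in at_left (ereal x). a < ?K u"
    \<comment> \<open>Negative a lie below every value of \<open>?K\<close>. For a >= 0 the
      assumption \<open>a < ?K (ereal x)\<close> rules out the branch with value 0, so x >
      0.\<close>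
    proof (cases "a < 0")
      case True
      moreover have "0 \<le> ?K u" for u
        using range by (auto simp only: subset_iff atLeastAtMost_iff rangeI)
      ultimately have "a < ?K u" for u
        by (rule less_le_trans)
      then show ?thesis
        by (intro always_eventually) blast
    next
      case False
      with a have x: "0 < x" and "a < Sup01 (f ` {s. s < ereal x})"
        by (auto split: if_splits)
      \<comment> \<open>Since a >= 0, the element exceeding a cannot be the 0 adjoined by
        \<open>Sup01\<close>, so it is a genuine value f s.\<close>
      with False obtain s where s: "s < ereal x" "a < f s"
        unfolding Sup01_def by (subst (asm) less_cSup_iff) (auto intro!: bdd_aboveI[of _ 1] simp: f[simplified])
      \<comment> \<open>The bound 0 keeps u positive, away from the branch where \<open>?K\<close>
        is 0; the bound s puts s among the indices for u.\<close>
      have "max 0 s < ereal x"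
        using s x by simp
      then have "\<forall>\<^sub>F u in at_left (ereal x). max 0 s < u \<and> u < ereal x"
        unfolding eventually_at_left[OF \<open>max 0 s < ereal x\<close>] by blast
      then show ?thesis
      proof (rule eventually_mono)
        fix u
        assume u: "max 0 s < u \<and> u < ereal x"
        then have "f s \<le> Sup01 (f ` {s. s < u})"
          by (intro Sup01_upper[OF sub]) auto
        with s u show "a < ?K u"
          by auto
      qed
    qed
  next
    fix a
    assume a: "?K (ereal x) < a"
    show "\<forall>\<^sub>F u in at_left (ereal x). ?K u < a"
      unfolding eventually_at_filter
    proof (intro always_eventually allI impI)
      fix u
      assume "u \<in> {..<ereal x}"
      \<comment> \<open>The upper half of the limit is monotonicity alone.\<close>
      then have "?K u \<le> ?K (ereal x)"
        by (intro monoD[OF mono]) auto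
      then show "?K u < a"
        using a by (rule le_less_trans)
    qed
  qed
  then have "continuous (at_left (ereal x)) ?K" for x :: real
    unfolding continuous_within .
  with range mono show ?thesis
    unfolding Delta_plus_def by auto
qed

lemma Hausdorff_kernel_in:
  fixes H :: "'a \<Rightarrow> 'b \<Rightarrow> 'c \<Rightarrow> real"
  assumes "\<And>p q s. p \<in> E \<Longrightarrow> q \<in> F \<Longrightarrow> H p q s \<in> {0..1}"
  shows "min (Inf01 ((\<lambda>p. Sup01 ((\<lambda>q. H p q s) ` F)) ` E))
      (Inf01 ((\<lambda>q. Sup01 ((\<lambda>p. H p q s) ` E)) ` F)) \<in> {0..1}"
proof -
  have "Inf01 ((\<lambda>p. Sup01 ((\<lambda>q. H p q s) ` F)) ` E) \<in> {0..1}"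
    using assms by (intro Inf01_in image_subsetI Sup01_in) blast
  moreover have "Inf01 ((\<lambda>q. Sup01 ((\<lambda>p. H p q s) ` E)) ` F) \<in> {0..1}"
    using assms by (intro Inf01_in image_subsetI Sup01_in) blast
  ultimately show ?thesis
    by (simp add: min_def)
qed

text \<open>The probabilistic Hausdorff distance is the left regularization of the min-inf-sup
  kernel in s, and that kernel stays in the unit interval.\<close>

lemma prob_Hausdorff_in_Delta_plus:
  assumes "\<And>p q s. p \<in> E \<Longrightarrow> q \<in> F \<Longrightarrow> H p q s \<in> {0..1}"
  shows "prob_Hausdorff H E F \<in> Delta_plus"
  unfolding prob_Hausdorff_def[abs_def]
  using assms by (intro left_regularization_in_Delta_plus Hausdorff_kernel_in)

text \<open>Each point p is its own best partner: \<open>H p p\<close> is \<open>eps0\<close>, so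
  for s > 0 every inner supremum is 1 and so is the kernel.\<close>

lemma prob_Hausdorff_self:
  assumes H: "\<And>p q s. p \<in> E \<Longrightarrow> q \<in> E \<Longrightarrow> H p q s \<in> {0..1}"
    and refl: "\<And>p. p \<in> E \<Longrightarrow> H p p = eps0"
  shows "prob_Hausdorff H E E = eps0"
proof (rule ext)
  fix t :: ereal
  define m where "m s = min (Inf01 ((\<lambda>p. Sup01 ((\<lambda>q. H p q s) ` E)) ` E))
    (Inf01 ((\<lambda>q. Sup01 ((\<lambda>p. H p q s) ` E)) ` E))" for s
  have m_pos: "m s = 1" if "0 < s" for s
  proof -
    have "Sup01 ((\<lambda>q. H p q s) ` E) = 1" "Sup01 ((\<lambda>q. H q p s) ` E) = 1" if "p \<in> E" for p
    proof -
      have "H p p s = 1"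
        using refl[OF that] \<open>0 < s\<close> by (simp add: eps0_def)
      then show "Sup01 ((\<lambda>q. H p q s) ` E) = 1" "Sup01 ((\<lambda>q. H q p s) ` E) = 1"
        using H that by (intro Sup01_eq_1; force)+
    qed
    then have "(\<lambda>p. Sup01 ((\<lambda>q. H p q s) ` E)) ` E \<subseteq> {1}"
      "(\<lambda>q. Sup01 ((\<lambda>p. H p q s) ` E)) ` E \<subseteq> {1}"
      by blast+
    \<comment> \<open>The 1 adjoined by \<open>Inf01\<close> makes both sets equal to {1} also when
      E is empty.\<close>
    then have "insert 1 ((\<lambda>p. Sup01 ((\<lambda>q. H p q s) ` E)) ` E) = {1}"
      "insert 1 ((\<lambda>q. Sup01 ((\<lambda>p. H p q s) ` E)) ` E) = {1}"
      by blast+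
    then show ?thesis
      unfolding m_def Inf01_def by (simp only: cInf_singleton min.idem)
  qed
  have "prob_Hausdorff H E E t = 1" if t: "0 < t" "t \<noteq> \<infinity>"
  proof -
    \<comment> \<open>One positive s below t, where the kernel is already 1, settles the
      supremum.\<close>
    obtain s where s: "0 < s" "s < t"
      using dense[OF t(1)] by blast
    have "m s \<in> {0..1}" for s
      unfolding m_def using H by (rule Hausdorff_kernel_in)
    then have "Sup01 (m ` {s. s < t}) = 1"
      using s m_pos by (intro Sup01_eq_1) force+
    with t show ?thesis
      by (simp add: prob_Hausdorff_def m_def)
  qed
  then show "prob_Hausdorff H E E t = eps0 t"
    by (cases "0 < t \<and> t \<noteq> \<infinity>") (auto simp: eps0_def prob_Hausdorff_def)
qed

text \<open>Each closure property uses its own law of \<open>\<tau>\<close>: identity for the empty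
  set, symmetry for complements, associativity for unions.\<close>

lemma (in triangle_function) algebra_tau_measurable:
  assumes \<Lambda>: "\<And>A. A \<subseteq> \<Omega> \<Longrightarrow> \<Lambda> A \<in> Delta_plus" and empty: "\<Lambda> {} = eps0"
  shows "algebra \<Omega> {E \<in> Pow \<Omega>. tau_measurable \<Omega> (Pow \<Omega>) \<Lambda> \<tau> E}" (is "algebra _ ?S")
  unfolding algebra_iff_Un
proof (intro conjI ballI)
  show "?S \<subseteq> Pow \<Omega>"
    by blast
  have "\<Lambda> (G \<inter> \<Omega>) = \<Lambda> G" if "G \<subseteq> \<Omega>" for G
    using that by (simp add: Int_absorb2)
  then show "{} \<in> ?S"
    by (auto simp: tau_measurable_def empty identity \<Lambda>)
next
  fix E
  assume E: "E \<in> ?S"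
  have "\<Lambda> G = \<tau> (\<Lambda> (G \<inter> (\<Omega> - E))) (\<Lambda> (G \<inter> E))" if "G \<subseteq> \<Omega>" for G
  proof -
    have "\<Lambda> G = \<tau> (\<Lambda> (G \<inter> E)) (\<Lambda> (G \<inter> (\<Omega> - E)))"
      using E that by (auto simp: tau_measurable_def)
    also have "\<dots> = \<tau> (\<Lambda> (G \<inter> (\<Omega> - E))) (\<Lambda> (G \<inter> E))"
      using that by (intro sym \<Lambda>) auto
    finally show ?thesis .
  qed
  then show "\<Omega> - E \<in> ?S"
    using E by (auto simp: tau_measurable_def double_diff)
next
  fix E F
  assume "E \<in> ?S" "F \<in> ?S"
  then have E: "E \<subseteq> \<Omega>" "\<And>G. G \<subseteq> \<Omega> \<Longrightarrow> \<Lambda> G = \<tau> (\<Lambda> (G \<inter> E)) (\<Lambda> (G \<inter> (\<Omega> - E)))"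
    and F: "F \<subseteq> \<Omega>" "\<And>G. G \<subseteq> \<Omega> \<Longrightarrow> \<Lambda> G = \<tau> (\<Lambda> (G \<inter> F)) (\<Lambda> (G \<inter> (\<Omega> - F)))"
    by (auto simp: tau_measurable_def)
  have "\<Lambda> G = \<tau> (\<Lambda> (G \<inter> (E \<union> F))) (\<Lambda> (G \<inter> (\<Omega> - (E \<union> F))))" if G: "G \<subseteq> \<Omega>" for G
  proof -
    \<comment> \<open>G is cut into its part in E, its part in F outside E, and the rest. E splits
      off \<open>?A\<close>, and F, tested on G outside E, separates \<open>?B\<close> from
      \<open>?C\<close>.\<close>
    let ?A = "G \<inter> E" and ?B = "G \<inter> (\<Omega> - E) \<inter> F" and ?C = "G \<inter> (\<Omega> - (E \<union> F))"
    have "G \<inter> (\<Omega> - E) \<inter> (\<Omega> - F) = ?C"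
      by blast
    then have "\<Lambda> (G \<inter> (\<Omega> - E)) = \<tau> (\<Lambda> ?B) (\<Lambda> ?C)"
      using F(2)[of "G \<inter> (\<Omega> - E)"] by auto
    then have "\<Lambda> G = \<tau> (\<Lambda> ?A) (\<tau> (\<Lambda> ?B) (\<Lambda> ?C))"
      using E(2)[OF G] by simp
    also have "\<dots> = \<tau> (\<tau> (\<Lambda> ?A) (\<Lambda> ?B)) (\<Lambda> ?C)"
      using G by (intro assoc[symmetric] \<Lambda>) auto
    \<comment> \<open>Measurability of E is used a second time, now with test set
      \<open>G \<inter> (E \<union> F)\<close>, to glue \<open>?A\<close> and \<open>?B\<close>
      together.\<close>
    also have "\<tau> (\<Lambda> ?A) (\<Lambda> ?B) = \<Lambda> (G \<inter> (E \<union> F))"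
    proof -
      have "G \<inter> (E \<union> F) \<inter> E = ?A" "G \<inter> (E \<union> F) \<inter> (\<Omega> - E) = ?B"
        by blast+
      then show ?thesis
        using E(2)[of "G \<inter> (E \<union> F)"] G by (simp only: le_infI1)
    qed
    finally show ?thesis .
  qed
  then show "E \<union> F \<in> ?S"
    using E(1) F(1) by (auto simp: tau_measurable_def)
qed

theorem theorem5p5:
  fixes \<Omega> :: "'a set"
    and H :: "'a \<Rightarrow> 'a \<Rightarrow> ereal \<Rightarrow> real"
    and \<tau> :: "(ereal \<Rightarrow> real) \<Rightarrow> (ereal \<Rightarrow> real) \<Rightarrow> (ereal \<Rightarrow> real)"
  assumes "PM_space \<Omega> H \<tau>"
  shows "algebra \<Omega> {E \<in> Pow \<Omega>. tau_measurable \<Omega> (Pow \<Omega>) (Lambda_H \<Omega> H) \<tau> E}"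
proof -
  interpret PM_space \<Omega> H \<tau>
    by fact
  have H: "H p q s \<in> {0..1}" if "p \<in> \<Omega>" "q \<in> \<Omega>" for p q s
    using dist_in[OF that] unfolding Delta_plus_def by blast
  show ?thesis
  proof (rule algebra_tau_measurable)
    show "Lambda_H \<Omega> H A \<in> Delta_plus" for A
      unfolding Lambda_H_def using H by (intro prob_Hausdorff_in_Delta_plus) auto
    \<comment> \<open>The complement of the empty set is \<Omega>, so the value at {} is the
      distance from \<Omega> to itself.\<close>
    have "prob_Hausdorff H \<Omega> \<Omega> = eps0"
      using H dist_eq_eps0_iff by (intro prob_Hausdorff_self) blast+
    then show "Lambda_H \<Omega> H {} = eps0"
      by (simp add: Lambda_H_def)
  qed
qed

end
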